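(* For any $\epsilon>0$, the algorithm which processes the front job of every chain $c$ with the fixed rate $(H_\omega\cdot i_c)^{-1}$, where $i_c$ is the position of $c$ in the static predicted order $\hat\preceq_0$, has a competitive ratio of at most $O(H_\omega^2\sqrt P\cdot\max\{1+\epsilon,\mathcal L(\epsilon)\})$ for minimizing the total weighted completion time on a single machine with online chain precedence constraints. For unit jobs, it is $O(H_\omega^2\sqrt n\cdot\max\{1+\epsilon,\mathcal L(\epsilon)\})$-competitive.
   Context: Problem (non-clairvoyant single-machine scheduling with online precedence constraints): $n$ jobs with processing requirements $p_j\ge0$ (unknown to the algorithm) and weights $w_j\ge0$; the precedence graph is a collection $\mathcal C$ of $\omega$ disjoint chains; a job is revealed (with its weight) and may be processed only when its predecessor in its chain is completed. Time is discrete; rates $R_j^t\ge0$, $\sum_jR_j^t\le1$; $C_j$ is the first $t$ with $\sum_{t'\le t}R_j^{t'}\ge p_j$. Objective: minimize $\sum_jw_jC_j$ versus the offline optimum. $P=\sum_jp_j$, $H_k=\sum_{i=1}^k1/i$; "unit jobs" means $p_j=1$ for all $j$. For a chain $c$ let $W_c$ be its total weight. A static weight order prediction $\hat\preceq_0$ is a total order on the chains given at time $0$, predicting the order by non-increasing $W_c$. For $\epsilon>0$, $\mathcal L(\epsilon)=\max_{c\in\mathcal C}\left|\left\{c'\in\mathcal C: \frac{W_c}{1+\epsilon}\ge W_{c'}\text{ and } c'\,\hat\preceq_0\,c\right\}\right|$.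
   Formalization: The first claim is proved for processing requirements p_j ≥ 1 (no job shorter than one time step) instead of p_j ≥ 0; without this it fails, e.g. for a single job with p tending to 0, where the ratio is 1 but the bound tends to 0. *)

theory Defs
  imports "HOL-Analysis.Analysis"
begin

text \<open>
  Jobs are named by natural numbers and a chain is the list of its jobs in precedence order.
  Fixing a concrete type of names, rather than a type variable, lets the constants hidden in
  the O-notation be quantified before the instance.
\<close>

type_synonym job = nat
type_synonym chain = "job list"

definition jobs :: "chain set \<Rightarrow> job set" where
  "jobs C = (\<Union>c\<in>C. set c)"

definition chain_instance :: "chain set \<Rightarrow> (job \<Rightarrow> real) \<Rightarrow> (job \<Rightarrow> real) \<Rightarrow> bool" where
  "chain_instance C p w \<longleftrightarrow>
     finite C \<and> C \<noteq> {} \<and>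
     (\<forall>c\<in>C. c \<noteq> [] \<and> distinct c) \<and>
     (\<forall>c\<in>C. \<forall>d\<in>C. c \<noteq> d \<longrightarrow> set c \<inter> set d = {}) \<and>
     (\<forall>j\<in>jobs C. 0 \<le> p j \<and> 0 \<le> w j)"

definition total_processing :: "chain set \<Rightarrow> (job \<Rightarrow> real) \<Rightarrow> real" where
  "total_processing C p = (\<Sum>j\<in>jobs C. p j)"

definition chain_weight :: "(job \<Rightarrow> real) \<Rightarrow> chain \<Rightarrow> real" where
  "chain_weight w c = (\<Sum>j\<in>set c. w j)"

text \<open>
  \<open>R j t\<close> is the rate of job \<open>j\<close> in time step \<open>t\<close>. The steps are numbered \<open>1, 2, \<dots>\<close>, so that
  a unit job processed at rate 1 from the start completes at time 1; \<open>R j 0\<close> is never used.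
\<close>

type_synonym schedule = "job \<Rightarrow> nat \<Rightarrow> real"

definition processed :: "schedule \<Rightarrow> job \<Rightarrow> nat \<Rightarrow> real" where
  "processed R j t = (\<Sum>s\<in>{1..t}. R j s)"

definition completion_time :: "(job \<Rightarrow> real) \<Rightarrow> schedule \<Rightarrow> job \<Rightarrow> nat" where
  "completion_time p R j = (LEAST t. p j \<le> processed R j t)"

definition feasible :: "chain set \<Rightarrow> (job \<Rightarrow> real) \<Rightarrow> schedule \<Rightarrow> bool" where
  "feasible C p R \<longleftrightarrow>
     (\<forall>j\<in>jobs C. \<forall>t\<ge>1. 0 \<le> R j t) \<and>
     (\<forall>t\<ge>1. (\<Sum>j\<in>jobs C. R j t) \<le> 1) \<and>
     (\<forall>c\<in>C. \<forall>k<length c. \<forall>i<k. \<forall>t\<ge>1.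
        0 < R (c ! k) t \<longrightarrow> p (c ! i) \<le> processed R (c ! i) (t - 1)) \<and>
     (\<forall>j\<in>jobs C. \<exists>t. p j \<le> processed R j t)"

definition weighted_completion ::
  "chain set \<Rightarrow> (job \<Rightarrow> real) \<Rightarrow> (job \<Rightarrow> real) \<Rightarrow> schedule \<Rightarrow> real" where
  "weighted_completion C p w R = (\<Sum>j\<in>jobs C. w j * real (completion_time p R j))"

definition opt :: "chain set \<Rightarrow> (job \<Rightarrow> real) \<Rightarrow> (job \<Rightarrow> real) \<Rightarrow> real" where
  "opt C p w = Inf {weighted_completion C p w R |R. feasible C p R}"

definition competitive ::
  "chain set \<Rightarrow> (job \<Rightarrow> real) \<Rightarrow> (job \<Rightarrow> real) \<Rightarrow> schedule \<Rightarrow> real \<Rightarrow> bool" where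
  "competitive C p w R \<rho> \<longleftrightarrow>
     feasible C p R \<and> weighted_completion C p w R \<le> \<rho> * opt C p w"

text \<open>
  The schedule that processes, in every step, the front job of each chain \<open>c\<close> at a fixed rate
  \<open>r c\<close>. Given the amounts \<open>q\<close> processed so far, the front job of \<open>c\<close> is its first unfinished job.
  The requirements \<open>p\<close> enter only through the completion of jobs, never through the rates.
\<close>

definition front_rate ::
  "chain set \<Rightarrow> (job \<Rightarrow> real) \<Rightarrow> (chain \<Rightarrow> real) \<Rightarrow> (job \<Rightarrow> real) \<Rightarrow> job \<Rightarrow> real" where
  "front_rate C p r q j = (\<Sum>c\<in>C. if find (\<lambda>i. q i < p i) c = Some j then r c else 0)"

primrec front_work ::
  "chain set \<Rightarrow> (job \<Rightarrow> real) \<Rightarrow> (chain \<Rightarrow> real) \<Rightarrow> nat \<Rightarrow> job \<Rightarrow> real" where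
  "front_work C p r 0 = (\<lambda>j. 0)"
| "front_work C p r (Suc t) =
     (\<lambda>j. front_work C p r t j + front_rate C p r (front_work C p r t) j)"

definition front_schedule ::
  "chain set \<Rightarrow> (job \<Rightarrow> real) \<Rightarrow> (chain \<Rightarrow> real) \<Rightarrow> schedule" where
  "front_schedule C p r = (\<lambda>j t. front_rate C p r (front_work C p r (t - 1)) j)"

lemma processed_front_schedule:
  "processed (front_schedule C p r) j t = front_work C p r t j"
  by (induction t) (simp_all add: processed_def front_schedule_def)

text \<open>
  A static weight order prediction is a linear order \<open>ord\<close> on the chains; \<open>(c', c) \<in> ord\<close> means
  that \<open>c'\<close> is predicted to be at least as heavy as \<open>c\<close> and precedes it.
\<close>

definition position :: "chain set \<Rightarrow> (chain \<times> chain) set \<Rightarrow> chain \<Rightarrow> nat" where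
  "position C ord c = card {c'\<in>C. (c', c) \<in> ord}"

definition static_order_schedule ::
  "chain set \<Rightarrow> (job \<Rightarrow> real) \<Rightarrow> (chain \<times> chain) set \<Rightarrow> schedule" where
  "static_order_schedule C p ord =
     front_schedule C p (\<lambda>c. inverse (harm (card C) * real (position C ord c)))"

definition order_error ::
  "chain set \<Rightarrow> (job \<Rightarrow> real) \<Rightarrow> (chain \<times> chain) set \<Rightarrow> real \<Rightarrow> nat" where
  "order_error C w ord \<epsilon> =
     (MAX c\<in>C. card {c'\<in>C. chain_weight w c / (1 + \<epsilon>) \<ge> chain_weight w c' \<and> (c', c) \<in> ord})"

end

theory Submission
  imports Defs
begin

text \<open>
  Let \<open>M = max (1 + \<epsilon>) L\<close>, let \<open>i\<close> be the position of a chain \<open>c\<close>, and let \<open>X\<close> be the sum of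
  \<open>w j\<close> times the work up to and including \<open>j\<close>, over the jobs \<open>j\<close> of \<open>c\<close>. The algorithm pays
  \<open>O(H i X)\<close> for \<open>c\<close>, since rounding up at most doubles the time spent on a job with requirement
  at least 1. The optimum is at least the sum of all \<open>X\<close>, which settles the chains with
  \<open>i \<le> 2 M sqrt P\<close>. For any other chain, at least \<open>i / 2\<close> chains have weight at least
  \<open>W c / (1 + \<epsilon>)\<close>; each of them needs a unit of work before it can complete any job, hence the
  optimum is at least of order \<open>W c i\<^sup>2 / (1 + \<epsilon>)\<close>. As \<open>X \<le> W c P c\<close>, where \<open>P c\<close> is the work of
  \<open>c\<close>, this gives \<open>i X \<le> O(M) OPT P c / sqrt P\<close>, and the \<open>P c\<close> add up to \<open>P\<close>.
\<close>

section \<open>Positions in the predicted order\<close>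

text \<open>The predecessor set of an earlier chain is a proper subset of that of a later one, which
  also contains the later chain itself. Totality makes distinct chains comparable.\<close>

lemma position_inj_on:
  assumes "finite C" "linear_order_on C ord"
  shows "inj_on (position C ord) C"
proof -
  have tr: "trans ord" and an: "antisym ord" and tot: "total_on C ord" and rf: "refl_on C ord"
    using assms(2) by (auto simp: order_on_defs)
  have lt: "position C ord c < position C ord d"
    if cd: "c \<in> C" "d \<in> C" "c \<noteq> d" "(c, d) \<in> ord" for c d
  proof -
    have "(d, c) \<notin> ord"
      using an cd by (auto dest: antisymD)
    moreover have "(d, d) \<in> ord"
      using rf cd by (auto dest: refl_onD)
    ultimately have "{c'\<in>C. (c', c) \<in> ord} \<subset> {c'\<in>C. (c', d) \<in> ord}"
      using cd transD[OF tr] by blast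
    then show ?thesis
      unfolding position_def using assms(1) by (intro psubset_card_mono) auto
  qed
  show ?thesis
  proof (rule inj_onI, rule ccontr)
    fix c d assume "c \<in> C" "d \<in> C" "position C ord c = position C ord d" "c \<noteq> d"
    then show False
      using tot lt[of c d] lt[of d c] by (auto simp: total_on_def)
  qed
qed

lemma position_ge_1:
  assumes "finite C" "linear_order_on C ord" "c \<in> C"
  shows "1 \<le> position C ord c"
proof -
  have "c \<in> {c'\<in>C. (c', c) \<in> ord}"
    using assms by (auto simp: order_on_defs dest: refl_onD)
  then show ?thesis
    unfolding position_def using assms(1) card_gt_0_iff[of "{c'\<in>C. (c', c) \<in> ord}"]
    by (auto simp: Suc_le_eq)
qed

lemma position_le_card:
  assumes "finite C"
  shows "position C ord c \<le> card C"
  unfolding position_def using assms by (intro card_mono) auto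

lemma harm_ge_1:
  assumes "1 \<le> n"
  shows "1 \<le> (harm n :: real)"
  using harm_mono[OF assms, where 'a = real] by (simp add: harm_def)

text \<open>The positions are distinct numbers in \<open>{1..card C}\<close>, so their inverses are
  among the terms of the harmonic sum. Hence the factor \<open>harm (card C)\<close> in the rates
  keeps their sum at most 1.\<close>

lemma sum_inverse_position_le_harm:
  assumes "finite C" "linear_order_on C ord"
  shows "(\<Sum>c\<in>C. inverse (real (position C ord c))) \<le> harm (card C)"
proof -
  have "(\<Sum>c\<in>C. inverse (real (position C ord c))) =
      (\<Sum>i\<in>position C ord ` C. inverse (real i))"
    using position_inj_on[OF assms] by (simp add: sum.reindex)
  also have "\<dots> \<le> (\<Sum>i\<in>{1..card C}. inverse (real i))"
    using assms position_ge_1[OF assms] position_le_card[OF assms(1)]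
    by (intro sum_mono2) auto
  finally show ?thesis
    by (simp add: harm_def)
qed

section \<open>Instances with requirements at least 1\<close>

locale long_jobs =
  fixes C :: "chain set" and p w :: "job \<Rightarrow> real"
  assumes inst: "chain_instance C p w"
    and p_ge_1: "j \<in> jobs C \<Longrightarrow> 1 \<le> p j"
begin

lemma finite_chains: "finite C"
  and chains_nonempty: "C \<noteq> {}"
  and chain_distinct: "c \<in> C \<Longrightarrow> distinct c"
  and chain_nonempty: "c \<in> C \<Longrightarrow> c \<noteq> []"
  and chains_disjoint: "c \<in> C \<Longrightarrow> d \<in> C \<Longrightarrow> j \<in> set c \<Longrightarrow> j \<in> set d \<Longrightarrow> c = d"
  and w_nonneg: "j \<in> jobs C \<Longrightarrow> 0 \<le> w j"
  using inst by (auto simp: chain_instance_def)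

lemma finite_jobs: "finite (jobs C)"
  using finite_chains by (auto simp: jobs_def)

lemma nth_in_jobs: "c \<in> C \<Longrightarrow> k < length c \<Longrightarrow> c ! k \<in> jobs C"
  unfolding jobs_def by (rule UN_I[of c]) simp_all

lemma sum_jobs: "(\<Sum>j\<in>jobs C. f j) = (\<Sum>c\<in>C. \<Sum>j\<in>set c. f j)"
  unfolding jobs_def
proof (rule sum.UNION_disjoint)
  show "\<forall>c\<in>C. \<forall>d\<in>C. c \<noteq> d \<longrightarrow> set c \<inter> set d = {}"
    using inst by (simp add: chain_instance_def)
qed (simp_all add: finite_chains)

lemma sum_chain: "c \<in> C \<Longrightarrow> (\<Sum>j\<in>set c. f j) = (\<Sum>k<length c. f (c ! k))"
  using sum.reindex_bij_betw[OF bij_betw_nth[of c "{..<length c}" "set c"], of f] chain_distinct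
  by simp

lemma card_chains_le_total: "real (card C) \<le> total_processing C p"
proof -
  have "real (card C) = (\<Sum>c\<in>C. 1)" by simp
  also have "\<dots> \<le> (\<Sum>c\<in>C. \<Sum>j\<in>set c. p j)"
  proof (rule sum_mono)
    fix c assume c: "c \<in> C"
    have "p (hd c) \<le> (\<Sum>j\<in>set c. p j)"
    proof (rule member_le_sum)
      fix j assume "j \<in> set c - {hd c}"
      then have "j \<in> jobs C" using c by (auto simp: jobs_def)
      then show "0 \<le> p j" using p_ge_1[of j] by simp
    qed (use chain_nonempty[OF c] in simp_all)
    moreover have "1 \<le> p (hd c)"
      using nth_in_jobs[OF c, of 0] chain_nonempty[OF c] by (intro p_ge_1) (simp add: hd_conv_nth)
    ultimately show "1 \<le> (\<Sum>j\<in>set c. p j)" by simp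
  qed
  finally show ?thesis
    by (simp add: total_processing_def sum_jobs)
qed

lemma total_ge_1: "1 \<le> total_processing C p"
proof -
  have "1 \<le> card C"
    using finite_chains chains_nonempty by (simp add: Suc_leI card_gt_0_iff)
  then show ?thesis
    using card_chains_le_total by linarith
qed

end

subsection \<open>Lower bounds on the cost of a feasible schedule\<close>

locale feasible_schedule = long_jobs +
  fixes R :: schedule
  assumes feas: "feasible C p R"
begin

lemma rate_nonneg: "j \<in> jobs C \<Longrightarrow> 1 \<le> t \<Longrightarrow> 0 \<le> R j t"
  using feas by (auto simp: feasible_def)

lemma processed_nonneg: "j \<in> jobs C \<Longrightarrow> 0 \<le> processed R j t"
  unfolding processed_def by (intro sum_nonneg) (auto intro: rate_nonneg)

lemma processed_mono: "j \<in> jobs C \<Longrightarrow> s \<le> t \<Longrightarrow> processed R j s \<le> processed R j t"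
  unfolding processed_def by (intro sum_mono2) (auto intro: rate_nonneg)

lemma processed_completion: "j \<in> jobs C \<Longrightarrow> p j \<le> processed R j (completion_time p R j)"
  using feas LeastI_ex[of "\<lambda>t. p j \<le> processed R j t"]
  by (auto simp: feasible_def completion_time_def)

lemma sum_processed_le:
  assumes "A \<subseteq> jobs C"
  shows "(\<Sum>j\<in>A. processed R j t) \<le> real t"
proof -
  have "(\<Sum>j\<in>A. processed R j t) \<le> (\<Sum>j\<in>jobs C. processed R j t)"
    using assms finite_jobs by (intro sum_mono2) (auto intro: processed_nonneg)
  also have "\<dots> = (\<Sum>s\<in>{1..t}. \<Sum>j\<in>jobs C. R j s)"
    unfolding processed_def by (rule sum.swap)
  also have "\<dots> \<le> (\<Sum>s\<in>{1..t}. 1)"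
    using feas by (intro sum_mono) (auto simp: feasible_def)
  finally show ?thesis by simp
qed

text \<open>When \<open>c ! k\<close> completes, its predecessors are complete too, and the distinct
  jobs of the prefix share a capacity of one unit per step.\<close>

lemma prefix_le_completion:
  assumes c: "c \<in> C" and k: "k < length c"
  shows "(\<Sum>i\<le>k. p (c ! i)) \<le> real (completion_time p R (c ! k))"
proof -
  define T where "T = completion_time p R (c ! k)"
  have jk: "c ! k \<in> jobs C" using nth_in_jobs[OF c k] .
  have done_k: "p (c ! k) \<le> processed R (c ! k) T"
    unfolding T_def using processed_completion[OF jk] .
  have "p (c ! i) \<le> processed R (c ! i) T" if "i \<le> k" for i
  proof (cases "i = k")
    case False
    \<comment> \<open>The precedence constraint speaks only of steps with a positive rate;
      \<open>1 \<le> p (c ! k)\<close> guarantees such a step up to \<open>T\<close>.\<close>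
    have "0 < (\<Sum>s\<in>{1..T}. R (c ! k) s)"
      using done_k p_ge_1[OF jk] by (simp add: processed_def)
    then obtain s where s: "s \<in> {1..T}" "0 < R (c ! k) s"
      by (meson not_less sum_nonpos)
    then have "p (c ! i) \<le> processed R (c ! i) (s - 1)"
      using feas c k False that unfolding feasible_def by auto
    also have "\<dots> \<le> processed R (c ! i) T"
      using s that k c by (intro processed_mono nth_in_jobs) auto
    finally show ?thesis .
  qed (use done_k in simp)
  then have "(\<Sum>i\<le>k. p (c ! i)) \<le> (\<Sum>i\<le>k. processed R (c ! i) T)"
    by (intro sum_mono) auto
  also have "\<dots> = (\<Sum>j\<in>(!) c ` {..k}. processed R j T)"
  proof -
    have "inj_on ((!) c) {..k}"
      using chain_distinct[OF c] k by (intro inj_on_nth) auto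
    then show ?thesis by (simp add: sum.reindex)
  qed
  also have "\<dots> \<le> real T"
    using c k by (intro sum_processed_le) (auto intro: nth_in_jobs)
  finally show ?thesis unfolding T_def .
qed

lemma prefix_cost_le:
  "(\<Sum>c\<in>C. \<Sum>k<length c. w (c ! k) * (\<Sum>i\<le>k. p (c ! i))) \<le> weighted_completion C p w R"
proof -
  have "(\<Sum>c\<in>C. \<Sum>k<length c. w (c ! k) * (\<Sum>i\<le>k. p (c ! i))) \<le>
      (\<Sum>c\<in>C. \<Sum>k<length c. w (c ! k) * real (completion_time p R (c ! k)))"
    by (intro sum_mono mult_left_mono prefix_le_completion w_nonneg nth_in_jobs) auto
  also have "\<dots> = weighted_completion C p w R"
    unfolding weighted_completion_def sum_jobs by (intro sum.cong refl sum_chain[symmetric])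
  finally show ?thesis .
qed

text \<open>Choose one completed job per chain; disjointness makes the choice injective. Each chosen
  job has absorbed at least one of the at most \<open>t\<close> units of work done by time
  \<open>t\<close>.\<close>

lemma card_started_le:
  "card {c\<in>C. \<exists>j\<in>set c. completion_time p R j \<le> t} \<le> t" (is "card ?A \<le> t")
proof -
  have "\<forall>c\<in>?A. \<exists>j. j \<in> set c \<and> completion_time p R j \<le> t" by blast
  from bchoice[OF this] obtain f where
    "\<forall>c\<in>?A. f c \<in> set c \<and> completion_time p R (f c) \<le> t" ..
  then have f: "f c \<in> set c \<and> completion_time p R (f c) \<le> t" if "c \<in> ?A" for c
    using that by (rule bspec)
  have jobs: "f ` ?A \<subseteq> jobs C" using f by (auto simp: jobs_def)
  have inj: "inj_on f ?A"
  proof (rule inj_onI)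
    fix c d assume "c \<in> ?A" "d \<in> ?A" "f c = f d"
    then show "c = d" using f[of c] f[of d] chains_disjoint[of c d "f c"] by auto
  qed
  have "real (card ?A) = (\<Sum>j\<in>f ` ?A. 1)"
    using inj by (simp add: card_image)
  also have "\<dots> \<le> (\<Sum>j\<in>f ` ?A. processed R j t)"
  proof (rule sum_mono)
    fix j assume j: "j \<in> f ` ?A"
    then have "j \<in> jobs C" "completion_time p R j \<le> t" using jobs f by auto
    then show "1 \<le> processed R j t"
      using p_ge_1 processed_completion processed_mono by (meson order_trans)
  qed
  also have "\<dots> \<le> real t" using sum_processed_le[OF jobs] .
  finally show ?thesis by simp
qed

text \<open>At most \<open>T\<close> chains have completed any job by time \<open>T\<close>. Every
  other chain of \<open>D\<close> pays its whole weight at times after \<open>T\<close>.\<close>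

lemma heavy_chains_cost_le:
  assumes D: "D \<subseteq> C" and heavy: "\<And>c. c \<in> D \<Longrightarrow> W \<le> chain_weight w c" and W: "0 \<le> W"
  shows "W * (real (card D))\<^sup>2 / 4 \<le> weighted_completion C p w R"
proof -
  \<comment> \<open>Rounding down makes both \<open>card D - T\<close> and \<open>T + 1\<close> at
    least \<open>card D / 2\<close>; their product yields the constant 1/4.\<close>
  define T where "T = card D div 2"
  define A where "A = {c\<in>C. \<exists>j\<in>set c. completion_time p R j \<le> T}"
  have cardA: "card A \<le> T" unfolding A_def by (rule card_started_le)
  have "card D - card A \<le> card (D - A)"
    using finite_chains by (intro diff_card_le_card_Diff) (simp add: A_def)
  then have late: "real (card D) / 2 \<le> real (card (D - A))"
    using cardA unfolding T_def by linarith
  have T1: "real (card D) / 2 \<le> real (T + 1)" unfolding T_def by linarith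
  have "W * (real (card D))\<^sup>2 / 4 = (real (card D) / 2) * (W * (real (card D) / 2))"
    by (simp add: power2_eq_square)
  also have "\<dots> \<le> real (card (D - A)) * (W * real (T + 1))"
    using late T1 W by (intro mult_mono) auto
  also have "\<dots> = (\<Sum>c\<in>D - A. W * real (T + 1))" by simp
  also have "\<dots> \<le> (\<Sum>c\<in>D - A. \<Sum>j\<in>set c. w j * real (completion_time p R j))"
  proof (rule sum_mono)
    fix c assume c: "c \<in> D - A"
    have "W * real (T + 1) \<le> chain_weight w c * real (T + 1)"
      using heavy c by (intro mult_right_mono) auto
    also have "\<dots> = (\<Sum>j\<in>set c. w j * real (T + 1))"
      by (simp add: chain_weight_def sum_distrib_right)
    also have "\<dots> \<le> (\<Sum>j\<in>set c. w j * real (completion_time p R j))"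
    proof (intro sum_mono mult_left_mono)
      fix j assume j: "j \<in> set c"
      then have "\<not> completion_time p R j \<le> T" using c D by (auto simp: A_def)
      then show "real (T + 1) \<le> real (completion_time p R j)" by linarith
      show "0 \<le> w j" using j c D by (intro w_nonneg) (auto simp: jobs_def)
    qed
    finally show "W * real (T + 1) \<le> (\<Sum>j\<in>set c. w j * real (completion_time p R j))" .
  qed
  also have "\<dots> \<le> (\<Sum>c\<in>C. \<Sum>j\<in>set c. w j * real (completion_time p R j))"
    using D finite_chains
    by (intro sum_mono2 sum_nonneg mult_nonneg_nonneg w_nonneg) (auto simp: jobs_def)
  finally show ?thesis
    by (simp add: weighted_completion_def sum_jobs)
qed

end

subsection \<open>Processing every chain at a fixed rate\<close>

text \<open>The bound on the sum gives feasibility, and \<open>r c \<le> 1\<close> limits how far a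
  single step can overshoot a requirement.\<close>

locale fixed_rates = long_jobs +
  fixes r :: "chain \<Rightarrow> real"
  assumes r_pos: "c \<in> C \<Longrightarrow> 0 < r c"
    and r_le_1: "c \<in> C \<Longrightarrow> r c \<le> 1"
    and sum_r_le_1: "(\<Sum>c\<in>C. r c) \<le> 1"
begin

text \<open>Chains are disjoint, so only the chain containing \<open>j\<close> can contribute to the
  sum in \<open>front_rate\<close>.\<close>

lemma front_rate_eq:
  assumes c: "c \<in> C" and j: "j \<in> set c"
  shows "front_rate C p r q j = (if find (\<lambda>i. q i < p i) c = Some j then r c else 0)"
proof -
  have "front_rate C p r q j =
      (\<Sum>d\<in>C. if d = c then if find (\<lambda>i. q i < p i) c = Some j then r c else 0 else 0)"
    unfolding front_rate_def
  proof (intro sum.cong refl)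
    fix d assume d: "d \<in> C"
    have "j \<in> set d" if "find (\<lambda>i. q i < p i) d = Some j"
      using that by (auto simp: find_Some_iff)
    then have "find (\<lambda>i. q i < p i) d \<noteq> Some j" if "d \<noteq> c"
      using that chains_disjoint[OF d c _ j] by blast
    then show "(if find (\<lambda>i. q i < p i) d = Some j then r d else 0) =
        (if d = c then if find (\<lambda>i. q i < p i) c = Some j then r c else 0 else 0)"
      by (cases "d = c") simp_all
  qed
  then show ?thesis using c finite_chains by simp
qed

lemma front_rate_nonneg: "0 \<le> front_rate C p r q j"
  unfolding front_rate_def by (intro sum_nonneg) (auto intro: less_imp_le r_pos)

lemma front_work_mono: "s \<le> t \<Longrightarrow> front_work C p r s j \<le> front_work C p r t j"
  by (rule lift_Suc_mono_le) (simp_all add: front_rate_nonneg)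

text \<open>Only an unfinished job receives work, so its requirement can be exceeded only in its
  last step, which adds \<open>r c\<close>.\<close>

lemma front_work_less:
  assumes "c \<in> C" "j \<in> set c"
  shows "front_work C p r t j < p j + r c"
proof (induction t)
  case 0
  have "1 \<le> p j" using assms by (intro p_ge_1) (auto simp: jobs_def)
  then show ?case using r_pos[OF assms(1)] by simp
next
  case (Suc t)
  have "front_work C p r t j < p j"
    if "find (\<lambda>i. front_work C p r t i < p i) c = Some j"
    using that by (auto simp: find_Some_iff)
  then show ?case
    using Suc by (auto simp: front_rate_eq[OF assms])
qed

text \<open>As long as \<open>c ! k\<close> is unfinished, every step spends the full rate of \<open>c\<close> on the first
  \<open>k + 1\<close> jobs.\<close>

lemma prefix_front_work:
  assumes c: "c \<in> C" and k: "k < length c" and "front_work C p r t (c ! k) < p (c ! k)"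
  shows "(\<Sum>i\<le>k. front_work C p r t (c ! i)) = r c * real t"
  using assms(3)
proof (induction t)
  case (Suc t)
  let ?q = "front_work C p r t"
  have unfinished: "?q (c ! k) < p (c ! k)"
    using Suc.prems front_work_mono[of t "Suc t" "c ! k"] by linarith
  obtain j where j: "find (\<lambda>i. ?q i < p i) c = Some j"
    using unfinished k by (cases "find (\<lambda>i. ?q i < p i) c") (auto simp: find_None_iff)
  then obtain l where l: "l < length c" "j = c ! l" "\<forall>i<l. \<not> ?q (c ! i) < p (c ! i)"
    by (auto simp: find_Some_iff)
  \<comment> \<open>The front job is the first unfinished one and \<open>c ! k\<close> is
    unfinished, so the front job lies in the prefix.\<close>
  have "l \<le> k" using l(3) unfinished by (meson not_less)
  have "(\<Sum>i\<le>k. front_rate C p r ?q (c ! i)) = (\<Sum>i\<le>k. if i = l then r c else 0)"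
    using l k j chain_distinct[OF c]
    by (intro sum.cong) (auto simp: front_rate_eq[OF c] nth_eq_iff_index_eq)
  also have "\<dots> = r c" using \<open>l \<le> k\<close> by simp
  finally show ?case
    using Suc.IH[OF unfinished] by (simp add: sum.distrib algebra_simps)
qed simp

text \<open>The prefix has absorbed exactly \<open>r c * t\<close>, while each of its jobs absorbs
  less than \<open>p + r c\<close>, which is at most \<open>2 * p\<close> because
  \<open>r c \<le> 1 \<le> p\<close>.\<close>

lemma unfinished_time_less:
  assumes c: "c \<in> C" and k: "k < length c" and u: "front_work C p r t (c ! k) < p (c ! k)"
  shows "real t < 2 * (\<Sum>i\<le>k. p (c ! i)) / r c"
proof -
  have "r c * real t = (\<Sum>i\<le>k. front_work C p r t (c ! i))"
    using prefix_front_work[OF assms] by simp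
  also have "\<dots> < (\<Sum>i\<le>k. 2 * p (c ! i))"
  proof (rule sum_strict_mono)
    fix i assume "i \<in> {..k}"
    then have i: "i < length c" using k by simp
    then show "front_work C p r t (c ! i) < 2 * p (c ! i)"
      using front_work_less[OF c, of "c ! i" t] p_ge_1[OF nth_in_jobs[OF c i]] r_le_1[OF c]
      by force
  qed auto
  finally show ?thesis
    using r_pos[OF c] by (simp add: field_simps sum_distrib_left)
qed

lemma front_schedule_finishes:
  assumes "c \<in> C" "k < length c"
  shows "\<exists>t. p (c ! k) \<le> front_work C p r t (c ! k)"
proof -
  obtain t :: nat where "2 * (\<Sum>i\<le>k. p (c ! i)) / r c \<le> real t"
    using real_arch_simple by blast
  then show ?thesis
    using unfinished_time_less[OF assms, of t] by (intro exI[of _ t]) linarith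
qed

text \<open>The factor 3 consists of 2 for the steps that leave the job unfinished and 1 for the
  completing step, which is absorbed because the prefix work divided by \<open>r c\<close> is at
  least 1.\<close>

lemma front_schedule_completion_le:
  assumes c: "c \<in> C" and k: "k < length c"
  shows "real (completion_time p (front_schedule C p r) (c ! k)) \<le> 3 * (\<Sum>i\<le>k. p (c ! i)) / r c"
proof -
  define T where "T = completion_time p (front_schedule C p r) (c ! k)"
  have T: "T = (LEAST t. p (c ! k) \<le> front_work C p r t (c ! k))"
    unfolding T_def completion_time_def processed_front_schedule ..
  have p1: "1 \<le> p (c ! i)" if "i \<le> k" for i
    using that k by (intro p_ge_1 nth_in_jobs[OF c]) simp
  have "1 \<le> p (c ! k)" using p1 by simp
  also have "\<dots> \<le> (\<Sum>i\<le>k. p (c ! i))"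
    using p1 by (intro member_le_sum) (auto intro: order_trans[OF zero_le_one])
  finally have prefix: "1 \<le> (\<Sum>i\<le>k. p (c ! i)) / r c"
    using r_pos[OF c] r_le_1[OF c] by (simp add: field_simps)
  show ?thesis
  proof (cases T)
    case 0
    then show ?thesis using prefix unfolding T_def[symmetric] by simp
  next
    case (Suc t)
    then have "front_work C p r t (c ! k) < p (c ! k)"
      using not_less_Least[of t "\<lambda>t. p (c ! k) \<le> front_work C p r t (c ! k)"] T by auto
    then have "real t < 2 * (\<Sum>i\<le>k. p (c ! i)) / r c"
      by (rule unfinished_time_less[OF c k])
    then show ?thesis using prefix Suc unfolding T_def[symmetric] by simp
  qed
qed

lemma feasible_front_schedule: "feasible C p (front_schedule C p r)"
  unfolding feasible_def processed_front_schedule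
proof (intro conjI ballI allI impI)
  fix j t
  show "0 \<le> front_schedule C p r j t"
    by (simp add: front_schedule_def front_rate_nonneg)
next
  fix t :: nat
  let ?q = "front_work C p r (t - 1)"
  have "(\<Sum>j\<in>jobs C. front_schedule C p r j t) =
      (\<Sum>c\<in>C. \<Sum>j\<in>jobs C. if find (\<lambda>i. ?q i < p i) c = Some j then r c else 0)"
    unfolding front_schedule_def front_rate_def by (rule sum.swap)
  also have "\<dots> \<le> (\<Sum>c\<in>C. r c)"
  proof (rule sum_mono)
    fix c assume "c \<in> C"
    \<comment> \<open>\<open>find\<close> returns at most one job, so a chain spends its rate at
      most once per step.\<close>
    then show "(\<Sum>j\<in>jobs C. if find (\<lambda>i. ?q i < p i) c = Some j then r c else 0) \<le> r c"
      using r_pos[of c] finite_jobs by (cases "find (\<lambda>i. ?q i < p i) c") auto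
  qed
  finally show "(\<Sum>j\<in>jobs C. front_schedule C p r j t) \<le> 1"
    using sum_r_le_1 by linarith
next
  fix c k i t
  assume c: "c \<in> C" and k: "k < length c" and i: "i < k"
    and pos: "0 < front_schedule C p r (c ! k) t"
  let ?q = "front_work C p r (t - 1)"
  have "find (\<lambda>i. ?q i < p i) c = Some (c ! k)"
    using pos c k by (auto simp: front_schedule_def front_rate_eq split: if_splits)
  then obtain l where l: "l < length c" "c ! k = c ! l" "\<forall>i<l. \<not> ?q (c ! i) < p (c ! i)"
    by (auto simp: find_Some_iff)
  then have "l = k" using chain_distinct[OF c] k by (simp add: nth_eq_iff_index_eq)
  then show "p (c ! i) \<le> ?q (c ! i)" using l i by auto
next
  fix j assume "j \<in> jobs C"
  then obtain c k where "c \<in> C" "k < length c" "j = c ! k"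
    by (auto simp: jobs_def in_set_conv_nth)
  then show "\<exists>t. p j \<le> front_work C p r t j"
    using front_schedule_finishes by auto
qed

lemma front_schedule_cost_le:
  "weighted_completion C p w (front_schedule C p r) \<le>
     3 * (\<Sum>c\<in>C. (\<Sum>k<length c. w (c ! k) * (\<Sum>i\<le>k. p (c ! i))) / r c)"
proof -
  have "weighted_completion C p w (front_schedule C p r) =
      (\<Sum>c\<in>C. \<Sum>k<length c.
        w (c ! k) * real (completion_time p (front_schedule C p r) (c ! k)))"
    unfolding weighted_completion_def sum_jobs by (intro sum.cong refl sum_chain)
  also have "\<dots> \<le> (\<Sum>c\<in>C. \<Sum>k<length c. w (c ! k) * (3 * (\<Sum>i\<le>k. p (c ! i)) / r c))"
    by (intro sum_mono mult_left_mono front_schedule_completion_le w_nonneg nth_in_jobs) auto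
  also have "\<dots> = 3 * (\<Sum>c\<in>C. (\<Sum>k<length c. w (c ! k) * (\<Sum>i\<le>k. p (c ! i))) / r c)"
    by (simp add: sum_distrib_left sum_divide_distrib mult_ac)
  finally show ?thesis .
qed

end

subsection \<open>Competitive ratio\<close>

text \<open>The two terms on the right cover small and large positions. Summed over all chains, each
  becomes a multiple of \<open>M * sqrt P\<close> times the cost of \<open>R\<close>. Allowing any
  feasible \<open>R\<close> avoids having to show that the optimum is attained.\<close>

lemma (in feasible_schedule) position_cost_le:
  fixes ord :: "(chain \<times> chain) set"
  assumes \<epsilon>: "0 < \<epsilon>" and c: "c \<in> C"
  defines "M \<equiv> max (1 + \<epsilon>) (real (order_error C w ord \<epsilon>))"
    and "P \<equiv> total_processing C p"
    and "X \<equiv> (\<Sum>k<length c. w (c ! k) * (\<Sum>i\<le>k. p (c ! i)))"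
  shows "real (position C ord c) * X \<le>
     2 * M * sqrt P * X + 16 * M * weighted_completion C p w R * (\<Sum>j\<in>set c. p j) / sqrt P"
proof -
  define i where "i = real (position C ord c)"
  define W where "W = chain_weight w c"
  define Q where "Q = (\<Sum>j\<in>set c. p j)"
  define V where "V = weighted_completion C p w R"
  have p0: "0 \<le> p (c ! k)" and w0: "0 \<le> w (c ! k)" if "k < length c" for k
    using p_ge_1[OF nth_in_jobs[OF c that]] w_nonneg[OF nth_in_jobs[OF c that]] by auto
  have X0: "0 \<le> X" unfolding X_def
    using p0 w0 by (intro sum_nonneg mult_nonneg_nonneg) auto
  have Q0: "0 \<le> Q" unfolding Q_def sum_chain[OF c] using p0 by (intro sum_nonneg) auto
  have W0: "0 \<le> W" unfolding W_def chain_weight_def sum_chain[OF c]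
    using w0 by (intro sum_nonneg) auto
  have V0: "0 \<le> V" unfolding V_def weighted_completion_def
    by (intro sum_nonneg mult_nonneg_nonneg w_nonneg) auto
  have M: "1 \<le> M" "1 + \<epsilon> \<le> M" "real (order_error C w ord \<epsilon>) \<le> M"
    unfolding M_def using \<epsilon> by auto
  have P: "1 \<le> sqrt P" unfolding P_def using total_ge_1 by simp
  have "X \<le> (\<Sum>k<length c. w (c ! k) * Q)"
    unfolding X_def Q_def sum_chain[OF c]
    using p0 w0 by (intro sum_mono mult_left_mono sum_mono2) auto
  also have "\<dots> = W * Q"
    by (simp add: W_def chain_weight_def sum_chain[OF c] sum_distrib_right)
  finally have XWQ: "X \<le> W * Q" .
  show ?thesis
  proof (cases "i \<le> 2 * M * sqrt P")
    case True
    then have "i * X \<le> 2 * M * sqrt P * X" using X0 by (rule mult_right_mono)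
    moreover have "0 \<le> 16 * M * V * Q / sqrt P" using M V0 Q0 P by simp
    ultimately show ?thesis unfolding i_def V_def Q_def by linarith
  next
    case False
    have MP: "M * 1 \<le> M * sqrt P" "1 * sqrt P \<le> M * sqrt P"
      using M P by (intro mult_left_mono mult_right_mono; simp)+
    \<comment> \<open>The first bound leaves at least half of the predecessors after removing the
      mispredicted ones; the second lets \<open>1 / i\<close> be replaced by
      \<open>1 / sqrt P\<close>.\<close>
    have i: "2 * M < i" "sqrt P < i" "0 < i" using False MP P by linarith+
    define L where "L = {c'\<in>C. W / (1 + \<epsilon>) \<ge> chain_weight w c' \<and> (c', c) \<in> ord}"
    \<comment> \<open>The chains predicted no later than \<open>c\<close> (including
      \<open>c\<close>) whose weight exceeds \<open>W / (1 + \<epsilon>)\<close>.\<close>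
    define D where "D = {c'\<in>C. (c', c) \<in> ord} - L"
    have "card L \<le> order_error C w ord \<epsilon>"
      unfolding order_error_def L_def W_def using finite_chains c by (intro Max_ge) auto
    then have "real (card L) \<le> M" using M by linarith
    moreover have "position C ord c - card L \<le> card D"
      unfolding position_def D_def
      using finite_chains by (intro diff_card_le_card_Diff) (simp add: L_def)
    ultimately have D: "i / 2 \<le> real (card D)" unfolding i_def using i(1)[unfolded i_def]
      by linarith
    have "W / (1 + \<epsilon>) * (i / 2)\<^sup>2 / 4 \<le> W / (1 + \<epsilon>) * (real (card D))\<^sup>2 / 4"
      using D W0 \<epsilon> by (intro divide_right_mono mult_left_mono power_mono) (auto simp: i_def)
    also have "\<dots> \<le> V"
      unfolding V_def using W0 \<epsilon> by (intro heavy_chains_cost_le) (auto simp: D_def L_def)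
    \<comment> \<open>The 16 comes from \<open>card D \<ge> i / 2\<close>, squared, and the division
      by 4 in \<open>heavy_chains_cost_le\<close>.\<close>
    finally have "W * i\<^sup>2 \<le> 16 * (1 + \<epsilon>) * V"
      using \<epsilon> by (simp add: field_simps power2_eq_square)
    also have "\<dots> \<le> 16 * M * V" using M V0 by (intro mult_right_mono) auto
    finally have "W * i\<^sup>2 \<le> 16 * M * V" .
    then have "W * i \<le> 16 * M * V / i"
      by (simp only: pos_le_divide_eq[OF i(3)] power2_eq_square mult.assoc)
    also have "\<dots> \<le> 16 * M * V / sqrt P"
      using i P M V0 by (intro divide_left_mono) auto
    finally have Wi: "W * i \<le> 16 * M * V / sqrt P" .
    have "i * X \<le> i * (W * Q)" using XWQ by (intro mult_left_mono) (auto simp: i_def)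
    also have "\<dots> = W * i * Q" by simp
    also have "\<dots> \<le> 16 * M * V / sqrt P * Q" using Wi Q0 by (rule mult_right_mono)
    finally have "i * X \<le> 16 * M * V * Q / sqrt P" by simp
    moreover have "0 \<le> 2 * M * sqrt P * X" using M P X0 by simp
    ultimately show ?thesis unfolding i_def V_def Q_def by linarith
  qed
qed

lemma (in long_jobs) static_order_schedule_competitive:
  assumes lin: "linear_order_on C ord" and \<epsilon>: "0 < \<epsilon>"
  shows "competitive C p w (static_order_schedule C p ord)
    (54 * ((harm (card C))\<^sup>2 * sqrt (total_processing C p)
      * max (1 + \<epsilon>) (real (order_error C w ord \<epsilon>))))"
proof -
  define H :: real where "H = harm (card C)"
  define r where "r = (\<lambda>c. inverse (H * real (position C ord c)))"
  define M where "M = max (1 + \<epsilon>) (real (order_error C w ord \<epsilon>))"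
  define P where "P = total_processing C p"
  \<comment> \<open>54 = 3 * (2 + 16): the factor 3 from the completion times, 2 and 16 from the two
    terms of \<open>position_cost_le\<close>.\<close>
  define \<rho> where "\<rho> = 54 * (H\<^sup>2 * sqrt P * M)"
  define X where "X = (\<lambda>c. \<Sum>k<length c. w (c ! k) * (\<Sum>i\<le>k. p (c ! i)))"
  have H: "1 \<le> H" unfolding H_def
    using finite_chains chains_nonempty by (intro harm_ge_1) (simp add: Suc_leI card_gt_0_iff)
  have M: "1 \<le> M" unfolding M_def using \<epsilon> by auto
  have P: "1 \<le> sqrt P" unfolding P_def using total_ge_1 by simp
  have pos: "1 \<le> real (position C ord c)" if "c \<in> C" for c
    using position_ge_1[OF finite_chains lin that] by simp
  interpret fixed_rates C p w r
  proof unfold_locales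
    fix c assume "c \<in> C"
    then have *: "1 * 1 \<le> H * real (position C ord c)"
      using H pos by (intro mult_mono) auto
    show "0 < r c" unfolding r_def
      using * by (intro positive_imp_inverse_positive) linarith
    show "r c \<le> 1" unfolding r_def
      using * by (intro inverse_le_1_iff[THEN iffD2]) linarith
  next
    have "(\<Sum>c\<in>C. r c) = inverse H * (\<Sum>c\<in>C. inverse (real (position C ord c)))"
      by (simp add: r_def sum_distrib_left)
    also have "\<dots> \<le> inverse H * H"
      using sum_inverse_position_le_harm[OF finite_chains lin] H
      by (intro mult_left_mono) (auto simp: H_def)
    finally show "(\<Sum>c\<in>C. r c) \<le> 1" using H by simp
  qed
  have S: "static_order_schedule C p ord = front_schedule C p r"
    by (simp add: static_order_schedule_def r_def H_def)
  have \<rho>0: "0 < \<rho>" unfolding \<rho>_def using H M P by simp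
  have bound: "weighted_completion C p w (front_schedule C p r) \<le> \<rho> * weighted_completion C p w R"
    if feas: "feasible C p R" for R
  proof -
    interpret feasible_schedule C p w R by unfold_locales (rule feas)
    define V where "V = weighted_completion C p w R"
    have V0: "0 \<le> V" unfolding V_def weighted_completion_def
      by (intro sum_nonneg mult_nonneg_nonneg w_nonneg) auto
    have XV: "(\<Sum>c\<in>C. X c) \<le> V" unfolding X_def V_def by (rule prefix_cost_le)
    have "weighted_completion C p w (front_schedule C p r) \<le> 3 * (\<Sum>c\<in>C. X c / r c)"
      unfolding X_def by (rule front_schedule_cost_le)
    also have "(\<Sum>c\<in>C. X c / r c) = H * (\<Sum>c\<in>C. real (position C ord c) * X c)"
      by (simp add: r_def sum_distrib_left field_simps)
    also have "(\<Sum>c\<in>C. real (position C ord c) * X c) \<le>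
        (\<Sum>c\<in>C. 2 * M * sqrt P * X c + 16 * M * V * (\<Sum>j\<in>set c. p j) / sqrt P)"
      unfolding M_def P_def X_def V_def by (intro sum_mono position_cost_le \<epsilon>)
    also have "\<dots> = 2 * M * sqrt P * (\<Sum>c\<in>C. X c) + 16 * M * V * (P / sqrt P)"
      by (simp add: sum.distrib sum_distrib_left sum_divide_distrib P_def total_processing_def
          sum_jobs)
    also have "P / sqrt P = sqrt P"
      using P by (intro real_div_sqrt) simp
    also have "2 * M * sqrt P * (\<Sum>c\<in>C. X c) \<le> 2 * M * sqrt P * V"
      using XV M P by (intro mult_left_mono) auto
    finally have "weighted_completion C p w (front_schedule C p r) \<le> H * (54 * M * sqrt P * V)"
      using H by (simp add: algebra_simps)
    \<comment> \<open>Since \<open>1 \<le> H\<close>, the factor \<open>H\<close> coming from the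
      rates may be raised to the square in the claimed ratio.\<close>
    also have "\<dots> \<le> H\<^sup>2 * (54 * M * sqrt P * V)"
      using H M P V0 by (intro mult_right_mono) (auto simp: power2_eq_square)
    finally show ?thesis by (simp add: \<rho>_def V_def mult_ac)
  qed
  \<comment> \<open>The infimum is taken over a nonempty set, as the front schedule is itself
    feasible, and \<open>bound\<close> makes the left side a lower bound of that set.\<close>
  have "weighted_completion C p w (front_schedule C p r) / \<rho> \<le> opt C p w"
    unfolding opt_def
    using feasible_front_schedule bound \<rho>0
    by (intro cInf_greatest) (auto simp: pos_divide_le_eq mult.commute)
  then have "competitive C p w (front_schedule C p r) \<rho>"
    using feasible_front_schedule \<rho>0 by (simp add: competitive_def pos_divide_le_eq mult.commute)
  then show ?thesis
    by (simp add: S \<rho>_def H_def P_def M_def)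
qed

theorem theorem10:
  shows "(\<exists>K>0. \<forall>C p w ord. \<forall>\<epsilon>>0.
            chain_instance C p w \<longrightarrow> (\<forall>j\<in>jobs C. 1 \<le> p j) \<longrightarrow> linear_order_on C ord \<longrightarrow>
            competitive C p w (static_order_schedule C p ord)
              (K * ((harm (card C))\<^sup>2 * sqrt (total_processing C p)
                    * max (1 + \<epsilon>) (real (order_error C w ord \<epsilon>)))))
       \<and> (\<exists>K>0. \<forall>C p w ord. \<forall>\<epsilon>>0.
            chain_instance C p w \<longrightarrow> (\<forall>j\<in>jobs C. p j = 1) \<longrightarrow> linear_order_on C ord \<longrightarrow>
            competitive C p w (static_order_schedule C p ord)
              (K * ((harm (card C))\<^sup>2 * sqrt (real (card (jobs C)))
                    * max (1 + \<epsilon>) (real (order_error C w ord \<epsilon>)))))"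
proof (intro conjI exI[of _ "54 :: real"] allI impI)
  fix C p w ord and \<epsilon> :: real
  assume "0 < \<epsilon>" "chain_instance C p w" "\<forall>j\<in>jobs C. 1 \<le> p j" "linear_order_on C ord"
  then show "competitive C p w (static_order_schedule C p ord)
      (54 * ((harm (card C))\<^sup>2 * sqrt (total_processing C p)
        * max (1 + \<epsilon>) (real (order_error C w ord \<epsilon>))))"
    by (intro long_jobs.static_order_schedule_competitive) (auto simp: long_jobs_def)
next
  fix C p w ord and \<epsilon> :: real
  assume *: "0 < \<epsilon>" "chain_instance C p w" "\<forall>j\<in>jobs C. p j = 1" "linear_order_on C ord"
  \<comment> \<open>For unit jobs the total work is the number of jobs, so the general bound
    specialises with the same constant.\<close>
  then have "total_processing C p = real (card (jobs C))"
    by (simp add: total_processing_def)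
  then show "competitive C p w (static_order_schedule C p ord)
      (54 * ((harm (card C))\<^sup>2 * sqrt (real (card (jobs C)))
        * max (1 + \<epsilon>) (real (order_error C w ord \<epsilon>))))"
    using * long_jobs.static_order_schedule_competitive[of C p w ord \<epsilon>]
    by (auto simp: long_jobs_def)
qed auto

end
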